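(* Let $A=\mathrm{diag}(\alpha_0,\dots,\alpha_n)$ with distinct real $\alpha_0,\dots,\alpha_n$. Each function $$F_k=x_k^2+\sum_{j=0,\,j\neq k}^n\frac{(x_jy_k-x_ky_j)^2}{\alpha_k-\alpha_j},\qquad k=0,\dots,n,$$ is an integral of motion for the Hamiltonian system $$\frac{dx}{dt}=\|x\|^2y,\qquad \frac{dy}{dt}=-Ax+\Big(\frac{1}{\|x\|^2}(Ax,x)-\|y\|^2\Big)x$$ on $\{(x,y)\in\mathbb R^{n+1}\times\mathbb R^{n+1}:\|x\|=\|x_0\|,\ (x,y)=0\}$, where $x_0\in\mathbb R^{n+1}$ is a fixed nonzero vector. Moreover, the functions $F_0,\dots,F_n$ are in involution relative to the canonical Poisson bracket in $\mathbb R^{n+1}\times\mathbb R^{n+1}$.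
   Context: $(\cdot,\cdot)$ and $\|\cdot\|$ are the Euclidean inner product and norm on $\mathbb R^{n+1}$, with coordinates $x=(x_0,\dots,x_n)$, $y=(y_0,\dots,y_n)$ (the fixed vector $x_0$ in the constraint $\|x\|=\|x_0\|$ only prescribes the radius of the sphere and is not the coordinate). The canonical Poisson bracket is $\{f,g\}=\sum_{i=0}^n\left(\frac{\partial f}{\partial x_i}\frac{\partial g}{\partial y_i}-\frac{\partial g}{\partial x_i}\frac{\partial f}{\partial y_i}\right)$; involution means $\{F_j,F_k\}=0$ for all $j,k$. *)

theory Defs
  imports "HOL-Analysis.Analysis"
begin

text \<open>Points of the phase space are pairs \<open>(x, y)\<close> of vectors in \<open>real ^ 'n\<close>; the
  finite index type \<open>'n\<close> plays the role of the index set \<open>{0, \<dots>, n}\<close>, so \<open>CARD('n) = n + 1\<close>.\<close>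

type_synonym 'n phase_point = "(real ^ 'n) \<times> (real ^ 'n)"

definition diag :: "('n::finite \<Rightarrow> real) \<Rightarrow> real ^ 'n ^ 'n" where
  "diag \<alpha> = (\<chi> i j. if i = j then \<alpha> i else 0)"

definition constraint_set :: "real ^ 'n::finite \<Rightarrow> 'n phase_point set" where
  "constraint_set x0 = {(x, y). norm x = norm x0 \<and> x \<bullet> y = 0}"

definition neumann_field :: "real ^ 'n::finite ^ 'n \<Rightarrow> 'n phase_point \<Rightarrow> 'n phase_point" where
  "neumann_field A = (\<lambda>(x, y).
     ((norm x)\<^sup>2 *\<^sub>R y,
      - (A *v x) + (1 / (norm x)\<^sup>2 * ((A *v x) \<bullet> x) - (norm y)\<^sup>2) *\<^sub>R x))"

definition uhlenbeck :: "('n::finite \<Rightarrow> real) \<Rightarrow> 'n \<Rightarrow> 'n phase_point \<Rightarrow> real" where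
  "uhlenbeck \<alpha> k = (\<lambda>(x, y).
     (x $ k)\<^sup>2 + (\<Sum>j\<in>UNIV - {k}. (x $ j * y $ k - x $ k * y $ j)\<^sup>2 / (\<alpha> k - \<alpha> j)))"

text \<open>Solutions are allowed on an arbitrary time interval (open, closed or half-open, bounded
  or not); at an endpoint belonging to the interval the derivative is one-sided. The solution
  is required to stay in the set \<open>M\<close> on which the system is considered.\<close>

definition solution_on ::
  "('a::real_normed_vector \<Rightarrow> 'a) \<Rightarrow> 'a set \<Rightarrow> real set \<Rightarrow> (real \<Rightarrow> 'a) \<Rightarrow> bool" where
  "solution_on X M T \<gamma> \<longleftrightarrow> is_interval T \<and>
     (\<forall>t\<in>T. \<gamma> t \<in> M \<and> (\<gamma> has_vector_derivative X (\<gamma> t)) (at t within T))"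

definition integral_of_motion ::
  "('a::real_normed_vector \<Rightarrow> 'a) \<Rightarrow> 'a set \<Rightarrow> ('a \<Rightarrow> real) \<Rightarrow> bool" where
  "integral_of_motion X M F \<longleftrightarrow>
     (\<forall>T \<gamma>. solution_on X M T \<gamma> \<longrightarrow> (\<lambda>t. F (\<gamma> t)) constant_on T)"

definition partial_x :: "'n::finite \<Rightarrow> ('n phase_point \<Rightarrow> real) \<Rightarrow> 'n phase_point \<Rightarrow> real" where
  "partial_x i f = (\<lambda>(x, y). deriv (\<lambda>t. f (x + t *\<^sub>R axis i 1, y)) 0)"

definition partial_y :: "'n::finite \<Rightarrow> ('n phase_point \<Rightarrow> real) \<Rightarrow> 'n phase_point \<Rightarrow> real" where
  "partial_y i f = (\<lambda>(x, y). deriv (\<lambda>t. f (x, y + t *\<^sub>R axis i 1)) 0)"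

definition poisson_bracket ::
  "('n::finite phase_point \<Rightarrow> real) \<Rightarrow> ('n phase_point \<Rightarrow> real) \<Rightarrow> 'n phase_point \<Rightarrow> real" where
  "poisson_bracket f g = (\<lambda>p. \<Sum>i\<in>UNIV.
     partial_x i f p * partial_y i g p - partial_x i g p * partial_y i f p)"

end

theory Submission
  imports Defs
begin

text \<open>Let \<open>m\<^sub>k\<^sub>j = x\<^sub>j y\<^sub>k - x\<^sub>k y\<^sub>j\<close>. Along the flow \<open>m\<^sub>k\<^sub>j\<close> has derivative \<open>(\<alpha>\<^sub>j - \<alpha>\<^sub>k) x\<^sub>j x\<^sub>k\<close>,
  which cancels the denominators in \<open>F\<^sub>k\<close>; the remaining sum \<open>-2 x\<^sub>k \<Sum>\<^sub>j m\<^sub>k\<^sub>j x\<^sub>j\<close> collapses to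
  \<open>-2 \<parallel>x\<parallel>\<^sup>2 x\<^sub>k y\<^sub>k\<close> because \<open>(x, y) = 0\<close>, and this is the negative of the derivative of \<open>x\<^sub>k\<^sup>2\<close>.

  For the involution put \<open>b\<^sub>k\<^sub>j = m\<^sub>k\<^sub>j / (\<alpha>\<^sub>k - \<alpha>\<^sub>j)\<close>, which is symmetric. Both partial gradients of
  \<open>F\<^sub>k\<close> are expressed by \<open>b\<close>, and the bracket becomes a sum over \<open>i\<close> of
  \<open>b\<^sub>j\<^sub>k b\<^sub>k\<^sub>i m\<^sub>j\<^sub>i - b\<^sub>j\<^sub>k b\<^sub>j\<^sub>i m\<^sub>k\<^sub>i - b\<^sub>j\<^sub>i b\<^sub>k\<^sub>i m\<^sub>j\<^sub>k\<close>, each of which vanishes by partial fractions.\<close>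

definition ang_mom :: "real ^ 'n \<Rightarrow> real ^ 'n \<Rightarrow> 'n \<Rightarrow> 'n \<Rightarrow> real" where
  "ang_mom x y k j = x $ j * y $ k - x $ k * y $ j"

text \<open>On the diagonal this is \<open>0 / 0 = 0\<close>, so sums over \<open>j \<noteq> k\<close> may be extended to all \<open>j\<close>.\<close>

definition ang_quot :: "('n \<Rightarrow> real) \<Rightarrow> real ^ 'n \<Rightarrow> real ^ 'n \<Rightarrow> 'n \<Rightarrow> 'n \<Rightarrow> real" where
  "ang_quot \<alpha> x y k j = ang_mom x y k j / (\<alpha> k - \<alpha> j)"

lemma ang_mom_self [simp]: "ang_mom x y k k = 0"
  by (simp add: ang_mom_def)

lemma ang_quot_self [simp]: "ang_quot \<alpha> x y k k = 0"
  by (simp add: ang_quot_def)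

text \<open>Swapping the indices changes the sign of both numerator and denominator.\<close>

lemma ang_quot_commute: "ang_quot \<alpha> x y k j = ang_quot \<alpha> x y j k"
proof -
  have "ang_mom x y k j = - ang_mom x y j k" "\<alpha> k - \<alpha> j = - (\<alpha> j - \<alpha> k)"
    by (simp_all add: ang_mom_def)
  then show ?thesis
    unfolding ang_quot_def by (metis minus_divide_divide)
qed

lemma uhlenbeck_eq:
  "uhlenbeck \<alpha> k (x, y) = (x $ k)\<^sup>2 + (\<Sum>j\<in>UNIV. (ang_mom x y k j)\<^sup>2 / (\<alpha> k - \<alpha> j))"
proof -
  have "(\<Sum>j\<in>UNIV. (ang_mom x y k j)\<^sup>2 / (\<alpha> k - \<alpha> j))
      = (\<Sum>j\<in>UNIV - {k}. (ang_mom x y k j)\<^sup>2 / (\<alpha> k - \<alpha> j))"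
    by (intro sum.mono_neutral_right) auto
  then show ?thesis
    by (simp add: uhlenbeck_def ang_mom_def)
qed

text \<open>Differentiating along an arbitrary curve serves three purposes: coordinate lines in
  \<open>x\<close> and in \<open>y\<close> give the partial derivatives, and solutions of the system
  give conservation. Working within \<open>T\<close> covers one-sided derivatives at
  endpoints.\<close>

lemma uhlenbeck_has_field_derivative:
  assumes x: "\<And>i. ((\<lambda>t. u t $ i) has_field_derivative u' $ i) (at t within T)"
    and y: "\<And>i. ((\<lambda>t. v t $ i) has_field_derivative v' $ i) (at t within T)"
  shows "((\<lambda>t. uhlenbeck \<alpha> k (u t, v t)) has_field_derivative
     2 * (u t $ k * u' $ k + (\<Sum>j\<in>UNIV. ang_quot \<alpha> (u t) (v t) k j *
       (u' $ j * v t $ k + u t $ j * v' $ k - u' $ k * v t $ j - u t $ k * v' $ j))))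
     (at t within T)"
  unfolding uhlenbeck_eq ang_mom_def divide_inverse
  by (rule derivative_eq_intros x y refl)+
    (simp add: ang_quot_def ang_mom_def sum_distrib_left algebra_simps divide_inverse)

lemma partial_x_uhlenbeck:
  "partial_x i (uhlenbeck \<alpha> k) (x, y) =
    2 * ((if i = k then x $ k - (\<Sum>j\<in>UNIV. ang_quot \<alpha> x y k j * y $ j) else 0)
      + ang_quot \<alpha> x y k i * y $ k)"
proof -
  \<comment> \<open>The curve is a coordinate line, with velocities \<open>axis i 1\<close> and
    \<open>0\<close>; the terms \<open>0 *\<^sub>R axis i 1\<close> are its value at time 0, in the
    form the rule produces.\<close>
  have "((\<lambda>t. uhlenbeck \<alpha> k (x + t *\<^sub>R axis i 1, y)) has_field_derivative
    2 * ((x + 0 *\<^sub>R axis i 1) $ k * axis i 1 $ k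
      + (\<Sum>j\<in>UNIV. ang_quot \<alpha> (x + 0 *\<^sub>R axis i 1) y k j *
       (axis i 1 $ j * y $ k + (x + 0 *\<^sub>R axis i 1) $ j * 0 $ k - axis i 1 $ k * y $ j
        - (x + 0 *\<^sub>R axis i 1) $ k * 0 $ j))))
     (at 0)"
    by (rule uhlenbeck_has_field_derivative) (auto intro!: derivative_eq_intros)
  then have "partial_x i (uhlenbeck \<alpha> k) (x, y) =
    2 * (x $ k * axis i 1 $ k
      + (\<Sum>j\<in>UNIV. ang_quot \<alpha> x y k j * (axis i 1 $ j * y $ k - axis i 1 $ k * y $ j)))"
    by (simp add: partial_x_def DERIV_imp_deriv)
  also have "\<dots> = 2 * (x $ k * axis i 1 $ k
      + ((\<Sum>j\<in>UNIV. if j = i then ang_quot \<alpha> x y k j * y $ k else 0)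
        - (\<Sum>j\<in>UNIV. ang_quot \<alpha> x y k j * y $ j) * axis i 1 $ k))"
    unfolding sum_distrib_right sum_subtractf [symmetric]
    by (intro arg_cong2 [where f = "(*)"] arg_cong2 [where f = "(+)"] sum.cong refl)
      (auto simp: axis_def algebra_simps)
  finally show ?thesis
    by (simp add: axis_def)
qed

lemma partial_y_uhlenbeck:
  "partial_y i (uhlenbeck \<alpha> k) (x, y) =
    2 * ((if i = k then \<Sum>j\<in>UNIV. ang_quot \<alpha> x y k j * x $ j else 0)
      - ang_quot \<alpha> x y k i * x $ k)"
proof -
  have "((\<lambda>t. uhlenbeck \<alpha> k (x, y + t *\<^sub>R axis i 1)) has_field_derivative
    2 * (x $ k * 0 $ k
      + (\<Sum>j\<in>UNIV. ang_quot \<alpha> x (y + 0 *\<^sub>R axis i 1) k j *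
       (0 $ j * (y + 0 *\<^sub>R axis i 1) $ k + x $ j * axis i 1 $ k
        - 0 $ k * (y + 0 *\<^sub>R axis i 1) $ j - x $ k * axis i 1 $ j))))
     (at 0)"
    by (rule uhlenbeck_has_field_derivative) (auto intro!: derivative_eq_intros)
  then have "partial_y i (uhlenbeck \<alpha> k) (x, y) =
    2 * (\<Sum>j\<in>UNIV. ang_quot \<alpha> x y k j * (x $ j * axis i 1 $ k - x $ k * axis i 1 $ j))"
    by (simp add: partial_y_def DERIV_imp_deriv)
  also have "\<dots> = 2 * ((\<Sum>j\<in>UNIV. ang_quot \<alpha> x y k j * x $ j) * axis i 1 $ k
      - (\<Sum>j\<in>UNIV. if j = i then ang_quot \<alpha> x y k j * x $ k else 0))"
    unfolding sum_distrib_right sum_subtractf [symmetric]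
    by (intro arg_cong2 [where f = "(*)"] sum.cong refl) (auto simp: axis_def algebra_simps)
  finally show ?thesis
    by (simp add: axis_def)
qed

lemma partial_fractions:
  fixes a b c :: real
  assumes "a \<noteq> b" "b \<noteq> c" "a \<noteq> c"
  shows "1 / (a - b) * (1 / (b - c)) - 1 / (a - b) * (1 / (a - c)) = 1 / (a - c) * (1 / (b - c))"
  using assms by (simp add: divide_simps)

text \<open>For distinct indices the product of the three angular momenta factors out, leaving
  \<open>partial_fractions\<close>. If \<open>i\<close> equals \<open>j\<close> or \<open>k\<close>,
  each term has a factor that vanishes on the diagonal.\<close>

lemma ang_quot_identity:
  assumes "inj \<alpha>" and "j \<noteq> k"
  shows "ang_quot \<alpha> x y j k * ang_quot \<alpha> x y k i * ang_mom x y j i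
     - ang_quot \<alpha> x y j k * ang_quot \<alpha> x y j i * ang_mom x y k i
     = ang_quot \<alpha> x y j i * ang_quot \<alpha> x y k i * ang_mom x y j k"
proof (cases "i = j \<or> i = k")
  case True
  then show ?thesis
    by auto
next
  case False
  with assms have "\<alpha> j \<noteq> \<alpha> k" "\<alpha> k \<noteq> \<alpha> i" "\<alpha> j \<noteq> \<alpha> i"
    by (auto simp: inj_eq)
  from arg_cong [OF partial_fractions [OF this],
      where f = "\<lambda>z. ang_mom x y j k * ang_mom x y j i * ang_mom x y k i * z"]
  show ?thesis
    by (simp add: ang_quot_def right_diff_distrib mult_ac)
qed

lemma poisson_bracket_uhlenbeck:
  assumes "inj \<alpha>"
  shows "poisson_bracket (uhlenbeck \<alpha> j) (uhlenbeck \<alpha> k) (x, y) = 0"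
proof (cases "j = k")
  case True
  then show ?thesis
    by (simp add: poisson_bracket_def)
next
  case False
  define b where "b = ang_quot \<alpha> x y"
  define S where "S k = (\<Sum>i\<in>UNIV. b k i * y $ i)" for k
  define R where "R k = (\<Sum>i\<in>UNIV. b k i * x $ i)" for k
  have sym: "b k j = b j k"
    unfolding b_def by (rule ang_quot_commute)
  \<comment> \<open>The diagonal parts of the gradients contribute only at \<open>i = j\<close> and
    \<open>i = k\<close>; the other products combine into \<open>ang_mom x y j k\<close>.\<close>
  have "poisson_bracket (uhlenbeck \<alpha> j) (uhlenbeck \<alpha> k) (x, y) =
     4 * (\<Sum>i\<in>UNIV. (if i = j then - (x $ j - S j) * b k i * x $ k - R j * b k i * y $ k else 0)
       + (if i = k then R k * b j i * y $ j + (x $ k - S k) * b j i * x $ j else 0)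
       - b j i * b k i * ang_mom x y j k)"
    unfolding poisson_bracket_def partial_x_uhlenbeck partial_y_uhlenbeck
      b_def [symmetric] S_def [symmetric] R_def [symmetric] sum_distrib_left
    using False by (intro sum.cong refl) (auto simp: ang_mom_def algebra_simps)
  \<comment> \<open>The two \<open>x $ j * x $ k\<close> terms, which come from the squares, cancel
    by \<open>sym\<close>.\<close>
  also have "\<dots> = 4 * (b j k * (S j * x $ k - R j * y $ k + R k * y $ j - S k * x $ j)
       - (\<Sum>i\<in>UNIV. b j i * b k i * ang_mom x y j k))"
    by (simp add: sum.distrib sum_subtractf sym algebra_simps)
  also have "b j k * (S j * x $ k - R j * y $ k + R k * y $ j - S k * x $ j)
     = (\<Sum>i\<in>UNIV. b j k * b k i * ang_mom x y j i - b j k * b j i * ang_mom x y k i)"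
    by (simp add: S_def R_def ang_mom_def sum_distrib_left sum_distrib_right algebra_simps
        sum.distrib sum_subtractf)
  finally show ?thesis
    using ang_quot_identity [OF assms False, of x y] by (simp add: b_def)
qed

lemma diag_mult_component: "(diag \<alpha> *v x) $ i = \<alpha> i * x $ i"
  by (simp add: diag_def matrix_vector_mult_def if_distrib [of "\<lambda>z. z * _"] cong: if_cong)

lemma uhlenbeck_integral_of_motion:
  assumes "inj \<alpha>"
  shows "integral_of_motion (neumann_field (diag \<alpha>)) (constraint_set x0) (uhlenbeck \<alpha> k)"
  unfolding integral_of_motion_def
proof (intro allI impI)
  fix T \<gamma>
  assume sol: "solution_on (neumann_field (diag \<alpha>)) (constraint_set x0) T \<gamma>"
  have "((\<lambda>t. uhlenbeck \<alpha> k (\<gamma> t)) has_field_derivative 0) (at t within T)" if "t \<in> T" for t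
  proof -
    obtain x y where xy: "\<gamma> t = (x, y)"
      by (cases "\<gamma> t")
    define c where "c = 1 / (norm x)\<^sup>2 * ((diag \<alpha> *v x) \<bullet> x) - (norm y)\<^sup>2"
    define x' where "x' = (norm x)\<^sup>2 *\<^sub>R y"
    define y' where "y' = - (diag \<alpha> *v x) + c *\<^sub>R x"
    have d: "(\<gamma> has_vector_derivative (x', y')) (at t within T)" and orth: "x \<bullet> y = 0"
      using sol \<open>t \<in> T\<close> xy
      by (auto simp: solution_on_def neumann_field_def constraint_set_def x'_def y'_def c_def
          dest!: bspec)
    have "((\<lambda>t. fst (\<gamma> t) $ i) has_field_derivative x' $ i) (at t within T)"
      "((\<lambda>t. snd (\<gamma> t) $ i) has_field_derivative y' $ i) (at t within T)" for i
      using bounded_linear.has_vector_derivative [OF bounded_linear_compose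
          [OF bounded_linear_vec_nth [of i] bounded_linear_fst] d]
        bounded_linear.has_vector_derivative [OF bounded_linear_compose
          [OF bounded_linear_vec_nth [of i] bounded_linear_snd] d]
      unfolding has_real_derivative_iff_has_vector_derivative by (simp_all only: fst_conv snd_conv)
    from uhlenbeck_has_field_derivative [OF this, of \<alpha> k]
    have "((\<lambda>t. uhlenbeck \<alpha> k (\<gamma> t)) has_field_derivative
       2 * (x $ k * x' $ k + (\<Sum>j\<in>UNIV. ang_quot \<alpha> x y k j *
       (x' $ j * y $ k + x $ j * y' $ k - x' $ k * y $ j - x $ k * y' $ j)))) (at t within T)"
      by (simp add: xy)
    moreover have "ang_quot \<alpha> x y k j *
       (x' $ j * y $ k + x $ j * y' $ k - x' $ k * y $ j - x $ k * y' $ j)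
       = x $ k * (x $ k * (x $ j * y $ j) - y $ k * (x $ j * x $ j))" for j
    proof -
      \<comment> \<open>Since \<open>x'\<close> is parallel to \<open>y\<close> and
        \<open>c *\<^sub>R x\<close> to \<open>x\<close>, both cancel by antisymmetry, leaving only
        the part from \<open>diag \<alpha>\<close>.\<close>
      have "x' $ j * y $ k + x $ j * y' $ k - x' $ k * y $ j - x $ k * y' $ j
        = - ((\<alpha> k - \<alpha> j) * (x $ j * x $ k))"
        by (simp add: x'_def y'_def diag_mult_component algebra_simps)
      \<comment> \<open>At \<open>k = j\<close> both sides are 0; otherwise injectivity makes the
        denominator nonzero.\<close>
      moreover have "ang_quot \<alpha> x y k j * (\<alpha> k - \<alpha> j) = ang_mom x y k j"
        using assms by (cases "k = j") (auto simp: ang_quot_def inj_eq)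
      ultimately have "ang_quot \<alpha> x y k j *
          (x' $ j * y $ k + x $ j * y' $ k - x' $ k * y $ j - x $ k * y' $ j)
          = - (ang_mom x y k j * (x $ j * x $ k))"
        by (metis mult.assoc mult_minus_right)
      then show ?thesis
        by (simp add: ang_mom_def algebra_simps)
    qed
    moreover have "(\<Sum>j\<in>UNIV. x $ k * (x $ k * (x $ j * y $ j) - y $ k * (x $ j * x $ j)))
        = x $ k * (x $ k * (x \<bullet> y) - y $ k * (x \<bullet> x))"
      by (simp add: inner_vec_def sum_distrib_left sum_subtractf right_diff_distrib)
    moreover have "x $ k * x' $ k + x $ k * (x $ k * (x \<bullet> y) - y $ k * (x \<bullet> x)) = 0"
      using orth by (simp add: x'_def power2_norm_eq_inner algebra_simps)
    ultimately show ?thesis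
      by (simp only: mult_zero_right)
  qed
  moreover have "convex T"
    using sol by (simp add: solution_on_def is_interval_convex)
  ultimately have "\<exists>c. \<forall>t\<in>T. uhlenbeck \<alpha> k (\<gamma> t) = c"
    using has_field_derivative_zero_constant by blast
  then show "(\<lambda>t. uhlenbeck \<alpha> k (\<gamma> t)) constant_on T"
    by (simp add: constant_on_def)
qed

theorem proposition11:
  fixes \<alpha> :: "'n::finite \<Rightarrow> real" and x0 :: "real ^ 'n"
  assumes "inj \<alpha>" and "x0 \<noteq> 0"
  shows "(\<forall>k. integral_of_motion (neumann_field (diag \<alpha>)) (constraint_set x0) (uhlenbeck \<alpha> k)) \<and>
    (\<forall>j k p. poisson_bracket (uhlenbeck \<alpha> j) (uhlenbeck \<alpha> k) p = 0)"
  using assms by (auto simp: uhlenbeck_integral_of_motion poisson_bracket_uhlenbeck)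

end
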